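(* Let $K_1,\dots,K_g\in\mathrm U(r)$ and let $\widehat N:\mathbb C\setminus[a_0,b_g]\to\mathbb C^{2r\times2r}$ satisfy: (i) $\widehat N$ is holomorphic on $\mathbb C\setminus[a_0,b_g]$, with continuous boundary values $\widehat N_\pm$ on $\mathbb R\setminus\mathcal E$; (ii) $\widehat N_+=\widehat N_-v$ on $\mathbb R\setminus\mathcal E$; (iii) $\widehat N(z)=O(z^{-1})$ as $z\to\infty$; (iv) $\widehat N(z)=O(|z-e|^{-1/4})$ as $z\to e$, for each $e\in\mathcal E$. Then $\widehat N\equiv0$.
   Context: Fix $g\ge0$, $r\ge1$ and real numbers $a_0<b_0<a_1<b_1<\cdots<a_g<b_g$; $\mathcal E=\{a_0,b_0,\dots,a_g,b_g\}$; $\mathrm U(r)$ is the group of $r\times r$ unitary matrices. $\widehat N_\pm(x)$ is the boundary value of $\widehat N$ from $\{\pm\operatorname{Im}z>0\}$. The jump matrix $v$ on $\mathbb R\setminus\mathcal E$ is $$v(x)=\begin{cases}\begin{pmatrix}0_r&I_r\\-I_r&0_r\end{pmatrix},&x\in(a_\ell,b_\ell),\ \ell=0,\dots,g,\\[4pt]\operatorname{diag}(K_j,K_j^{-1}),&x\in(b_{j-1},a_j),\ j=1,\dots,g,\\[2pt]I_{2r},&x\in\mathbb R\setminus[a_0,b_g].\end{cases}$$ *)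

theory Defs
  imports "HOL-Complex_Analysis.Complex_Analysis" "HOL-Library.Landau_Symbols"
begin

definition adjoint_matrix :: "complex ^ 'n ^ 'm \<Rightarrow> complex ^ 'm ^ 'n" where
  "adjoint_matrix A = (\<chi> i j. cnj (A $ j $ i))"

definition unitary_matrix :: "complex ^ 'n ^ 'n \<Rightarrow> bool" where
  "unitary_matrix U \<longleftrightarrow> adjoint_matrix U ** U = mat 1 \<and> U ** adjoint_matrix U = mat 1"

text \<open>
  With \<open>r = CARD('r)\<close>, a complex \<open>2r \<times> 2r\<close> matrix is indexed by the sum type \<open>'r + 'r\<close>;
  \<open>Inl\<close> indexes the first \<open>r\<close> rows (columns) and \<open>Inr\<close> the last \<open>r\<close>.
\<close>

definition block_matrix ::
  "complex ^ 'r ^ 'r \<Rightarrow> complex ^ 'r ^ 'r \<Rightarrow> complex ^ 'r ^ 'r \<Rightarrow> complex ^ 'r ^ 'r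
     \<Rightarrow> complex ^ ('r + 'r) ^ ('r + 'r)" where
  "block_matrix A B C D = (\<chi> i j.
     case i of
       Inl k \<Rightarrow> (case j of Inl l \<Rightarrow> A $ k $ l | Inr l \<Rightarrow> B $ k $ l)
     | Inr k \<Rightarrow> (case j of Inl l \<Rightarrow> C $ k $ l | Inr l \<Rightarrow> D $ k $ l))"

definition band_endpoints :: "nat \<Rightarrow> (nat \<Rightarrow> real) \<Rightarrow> (nat \<Rightarrow> real) \<Rightarrow> real set" where
  "band_endpoints g a b = a ` {..g} \<union> b ` {..g}"

text \<open>
  When \<open>a 0 < b 0 < a 1 < \<dots> < a g < b g\<close>, the intervals below are pairwise disjoint, so the index
  selected by \<open>THE\<close> is determined. The function is only meaningful off the endpoints.
\<close>

definition jump_matrix ::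
  "nat \<Rightarrow> (nat \<Rightarrow> real) \<Rightarrow> (nat \<Rightarrow> real) \<Rightarrow> (nat \<Rightarrow> complex ^ 'r ^ 'r) \<Rightarrow> real
     \<Rightarrow> complex ^ ('r + 'r) ^ ('r + 'r)" where
  "jump_matrix g a b K x =
     (if \<exists>l\<in>{0..g}. x \<in> {a l<..<b l} then block_matrix 0 (mat 1) (- mat 1) 0
      else if \<exists>j\<in>{1..g}. x \<in> {b (j - 1)<..<a j} then
        (let j = (THE j. j \<in> {1..g} \<and> x \<in> {b (j - 1)<..<a j})
         in block_matrix (K j) 0 0 (matrix_inv (K j)))
      else mat 1)"

end

theory Submission
  imports Defs
begin

text \<open>
  The proof finds a holomorphic function on the upper half plane whose boundary values have
  nonnegative real part but total integral zero. Write a row of \<open>N\<close> as \<open>n = (n1, n2)\<close> in blocks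
  and put
  \[ h(z) = n2(z) n1(\bar z)^* - n1(z) n2(\bar z)^*, \qquad \mathrm{Im}\, z > 0. \]
  Since \<open>n(\bar z)\<close> tends to the lower boundary value, the jump relation expresses the boundary
  value of \<open>h\<close> through \<open>n_-\<close> alone. On a band the jump exchanges the two blocks up to a sign, so
  \<open>h\<^sub>+\<close> is \<open>|n_-|^2\<close>. On a gap, unitarity of \<open>K\<close> turns the two terms into \<open>\bar q\<close> and \<open>q\<close> with
  \<open>q = n1_- K n2_-^*\<close>, and outside \<open>[a\<^sub>0, b\<^sub>g]\<close> the same holds with \<open>K = 1\<close>; in both cases \<open>h\<^sub>+\<close>
  is purely imaginary. The more familiar pairing \<open>n(z) n(\bar z)^*\<close> would not do: on a gap it
  leaves the form \<open>v + v^*\<close>, which need not be semidefinite.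

  The growth conditions are what is needed to integrate \<open>h\<close> over the real line: \<open>h = O(z^{-2})\<close> at
  infinity, and near an endpoint the two factors of order \<open>-1/4\<close> produce the integrable
  singularity \<open>|z - e|^{-1/2}\<close>. Cauchy's theorem and dominated convergence give
  \<open>\<integral> h\<^sub>+ = 0\<close> (lemma \<open>boundary_real_part_vanishes\<close>), so \<open>n_-\<close>, and by the jump also
  \<open>n\<^sub>+\<close>, vanishes on every band. A holomorphic function with zero boundary values on an
  interval is zero (lemma \<open>zero_from_zero_boundary_values\<close>), and analytic continuation carries
  this from the upper half plane to the whole slit plane.
\<close>

section \<open>Holomorphic functions on the upper half plane with boundary singularities\<close>

text \<open>
  A quantitative form of the vanishing of the integral over a horizontal line. The contour is closed
  by a rectangle whose height equals the half-width \<open>T\<close>, so that the other three sides have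
  length \<open>4 T\<close> in total and stay at distance \<open>T\<close> from the origin, where \<open>h\<close> is at most
  \<open>C / T\<^sup>2\<close>. The bound does not depend on \<open>y\<close>, and so survives the limit \<open>y \<rightarrow> 0\<close>.
\<close>

lemma horizontal_integral_bound:
  fixes h :: "complex \<Rightarrow> complex"
  assumes hol: "h holomorphic_on {z. Im z > 0}"
    and decay: "\<And>z. Im z > 0 \<Longrightarrow> T \<le> norm z \<Longrightarrow> norm (h z) \<le> C / (norm z)\<^sup>2"
    and "T > 0" "y > 0" "C \<ge> 0"
  obtains J where "((\<lambda>x. h (Complex x y)) has_integral J) {-T..T}" "norm J \<le> 4 * C / T"
proof -
  obtain G where G: "\<And>z. Im z > 0 \<Longrightarrow> (G has_field_derivative h z) (at z within {z. Im z > 0})"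
    using holomorphic_convex_primitive'[OF convex_halfspace_Im_gt open_halfspace_Im_gt hol]
    by (metis mem_Collect_eq)
  have Gat: "(G has_field_derivative h z) (at z)" if "Im z > 0" for z
    using G[OF that] that by (simp add: at_within_open[OF _ open_halfspace_Im_gt])
  define J where "J = G (Complex T y) - G (Complex (-T) y)"
  have int: "((\<lambda>x. h (Complex x y)) has_integral J) {-T..T}"
    unfolding J_def
  proof (rule fundamental_theorem_of_calculus)
    fix x assume "x \<in> {-T..T}"
    have "((\<lambda>x. of_real x + \<i> * of_real y) has_vector_derivative 1) (at x)"
      by (auto intro!: derivative_eq_intros)
    then have "((\<lambda>x. Complex x y) has_vector_derivative 1) (at x)"
      by (simp add: Complex_eq)
    from field_vector_diff_chain_at[OF this Gat] \<open>y > 0\<close>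
    have "((\<lambda>x. G (Complex x y)) has_vector_derivative h (Complex x y)) (at x)"
      by (simp add: o_def)
    then show "((\<lambda>x. G (Complex x y)) has_vector_derivative h (Complex x y)) (at x within {-T..T})"
      by (rule has_vector_derivative_at_within)
  qed (use \<open>T > 0\<close> in simp)
  have far: "norm (h z) \<le> C / T\<^sup>2" if "Im z > 0" "T \<le> norm z" for z
  proof -
    have "norm (h z) \<le> C / (norm z)\<^sup>2" using decay that by blast
    also have "\<dots> \<le> C / T\<^sup>2"
      using that \<open>T > 0\<close> \<open>C \<ge> 0\<close> by (intro divide_left_mono power_mono mult_pos_pos) auto
    finally show ?thesis .
  qed
  \<comment> \<open>Instead of integrating \<open>h\<close> along the remaining sides, bound the increments of its primitive.\<close>
  have side: "norm (G p - G q) \<le> C / T\<^sup>2 * norm (p - q)"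
    if "convex S" "p \<in> S" "q \<in> S" "\<And>z. z \<in> S \<Longrightarrow> Im z > 0 \<and> T \<le> norm z" for p q S
    using that far
    by (intro field_differentiable_bound[where S=S and f'=h]) (auto intro!: DERIV_subset[OF Gat])
  have vert: "norm (G (Complex s y) - G (Complex s (y + T))) \<le> C / T\<^sup>2 * T" if "\<bar>s\<bar> = T" for s
  proof -
    have conv: "convex ({z. Re z = s} \<inter> {z. Im z > 0})"
      using convex_Int[OF convex_hyperplane[of "1::complex" s] convex_halfspace_Im_gt[of 0]] by simp
    have "Im z > 0 \<and> T \<le> norm z" if "z \<in> {z. Re z = s} \<inter> {z. Im z > 0}" for z
      using that abs_Re_le_cmod[of z] unfolding \<open>\<bar>s\<bar> = T\<close>[symmetric] by simp
    from side[OF conv _ _ this]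
    have "norm (G (Complex s y) - G (Complex s (y + T)))
        \<le> C / T\<^sup>2 * norm (Complex s y - Complex s (y + T))"
      using \<open>y > 0\<close> \<open>T > 0\<close> by simp
    also have "norm (Complex s y - Complex s (y + T)) = T"
      using \<open>T > 0\<close> by (simp add: cmod_def)
    finally show ?thesis .
  qed
  have horiz: "norm (G (Complex T (y + T)) - G (Complex (-T) (y + T))) \<le> C / T\<^sup>2 * (2 * T)"
  proof -
    have conv: "convex {z. Im z = y + T}"
      using convex_hyperplane[of \<i> "y + T"] by simp
    have "Im z > 0 \<and> T \<le> norm z" if "z \<in> {z. Im z = y + T}" for z
      using that abs_Im_le_cmod[of z] \<open>y > 0\<close> \<open>T > 0\<close> by auto
    from side[OF conv _ _ this]
    have "norm (G (Complex T (y + T)) - G (Complex (-T) (y + T)))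
        \<le> C / T\<^sup>2 * norm (Complex T (y + T) - Complex (-T) (y + T))"
      by simp
    also have "norm (Complex T (y + T) - Complex (-T) (y + T)) = 2 * T"
      using \<open>T > 0\<close> by (simp add: cmod_def real_sqrt_mult)
    finally show ?thesis .
  qed
  have "J = (G (Complex T y) - G (Complex T (y + T)))
      + (G (Complex T (y + T)) - G (Complex (-T) (y + T)))
      - (G (Complex (-T) y) - G (Complex (-T) (y + T)))"
    by (simp add: J_def)
  also have "norm \<dots> \<le> C / T\<^sup>2 * T + C / T\<^sup>2 * (2 * T) + C / T\<^sup>2 * T"
    using \<open>T > 0\<close>
    by (intro norm_triangle_le_diff norm_triangle_le add_mono vert horiz) auto
  also have "\<dots> = 4 * C / T"
    using \<open>T > 0\<close> by (simp add: field_simps power2_eq_square)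
  finally show thesis using int that by blast
qed

lemma integrable_inverse_sqrt_singularity:
  fixes e :: real
  shows "(\<lambda>x. \<bar>x - e\<bar> powr (-1/2)) integrable_on {c..d}"
proof (cases "c \<le> d")
  case True
  \<comment> \<open>The primitive is continuous at \<open>e\<close>, so the fundamental theorem applies across the singularity.\<close>
  define F where "F = (\<lambda>x. sgn (x - e) * (2 * sqrt \<bar>x - e\<bar>))"
  have F_eq: "F = (\<lambda>x. 2 * sqrt (max 0 (x - e)) - 2 * sqrt (max 0 (e - x)))"
    by (auto simp: F_def fun_eq_iff sgn_if max_def)
  have "((\<lambda>x. \<bar>x - e\<bar> powr (-1/2)) has_integral (F d - F c)) {c..d}"
  proof (rule fundamental_theorem_of_calculus_strong[where S="{e}"])
    show "continuous_on {c..d} F"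
      unfolding F_eq by (intro continuous_intros)
    fix x assume x: "x \<in> {c..d} - {e}"
    have "(F has_real_derivative \<bar>x - e\<bar> powr (-1/2)) (at x)"
    proof (cases "x > e")
      case True
      have "((\<lambda>x. 2 * sqrt (x - e)) has_real_derivative \<bar>x - e\<bar> powr (-1/2)) (at x)"
        using True
        by (auto intro!: derivative_eq_intros simp: powr_minus powr_half_sqrt divide_simps)
      moreover have "\<forall>\<^sub>F t in nhds x. F t = 2 * sqrt (t - e)"
        using eventually_nhds_in_open[of "{e<..}" x] True
        by (simp, elim eventually_mono) (simp add: F_def)
      ultimately show ?thesis by (rule DERIV_cong_ev[OF refl _ refl, THEN iffD2, rotated])
    next
      case False
      with x have "x < e" by auto
      then have "((\<lambda>x. - (2 * sqrt (e - x))) has_real_derivative \<bar>x - e\<bar> powr (-1/2)) (at x)"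
        by (auto intro!: derivative_eq_intros simp: powr_minus powr_half_sqrt divide_simps)
      moreover have "\<forall>\<^sub>F t in nhds x. F t = - (2 * sqrt (e - t))"
        using eventually_nhds_in_open[of "{..<e}" x] \<open>x < e\<close>
        by (simp, elim eventually_mono) (simp add: F_def)
      ultimately show ?thesis by (rule DERIV_cong_ev[OF refl _ refl, THEN iffD2, rotated])
    qed
    then show "(F has_vector_derivative \<bar>x - e\<bar> powr (-1/2)) (at x)"
      by (simp add: has_real_derivative_iff_has_vector_derivative)
  qed (use True in auto)
  then show ?thesis by blast
qed auto

lemma locally_bounded_above_on_compact:
  fixes f :: "'a::topological_space \<Rightarrow> real"
  assumes "compact Q"
    and loc: "\<And>p. p \<in> Q \<Longrightarrow> \<exists>M. \<forall>\<^sub>F z in nhds p. z \<in> S \<longrightarrow> f z \<le> M"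
  shows "\<exists>M. \<forall>z\<in>Q \<inter> S. f z \<le> M"
proof -
  have "\<exists>U M. open U \<and> p \<in> U \<and> (\<forall>z\<in>U \<inter> S. f z \<le> M)" if "p \<in> Q" for p
    using loc[OF that] unfolding eventually_nhds by blast
  then obtain U M where U: "\<And>p. p \<in> Q \<Longrightarrow> open (U p)" "\<And>p. p \<in> Q \<Longrightarrow> p \<in> U p"
      "\<And>p z. p \<in> Q \<Longrightarrow> z \<in> U p \<inter> S \<Longrightarrow> f z \<le> M p"
    by metis
  obtain P where P: "P \<subseteq> Q" "finite P" "Q \<subseteq> (\<Union>p\<in>P. U p)"
    using compactE_image[OF \<open>compact Q\<close>, of Q U] U by blast
  have "f z \<le> (\<Sum>p\<in>P. \<bar>M p\<bar>)" if "z \<in> Q \<inter> S" for z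
  proof -
    from that P obtain p where p: "p \<in> P" "z \<in> U p" by blast
    with U(3)[of p z] P that have "f z \<le> \<bar>M p\<bar>" by fastforce
    also have "\<dots> \<le> (\<Sum>p\<in>P. \<bar>M p\<bar>)" using p P by (intro member_le_sum) auto
    finally show ?thesis .
  qed
  then show ?thesis by blast
qed

text \<open>
  The majorant for the limit \<open>y \<rightarrow> 0\<close>. It depends on \<open>x\<close> only, because
  \<open>|z - e| \<ge> |Re z - e|\<close> and the exponent is negative. Each point of the compact rectangle has a
  neighbourhood with such a bound, by continuity, by convergence to the boundary value, or by the
  growth condition; compactness makes the constant uniform.
\<close>

lemma upper_halfplane_dominated:
  fixes h :: "complex \<Rightarrow> complex" and E :: "real set"
  defines "w \<equiv> \<lambda>x. 1 + (\<Sum>e\<in>E. \<bar>x - e\<bar> powr (-1/2))"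
  assumes "finite E"
    and cont: "continuous_on {z. Im z > 0} h"
    and boundary: "\<And>x. x \<notin> E \<Longrightarrow> (h \<longlongrightarrow> hp x) (at (of_real x) within {z. Im z > 0})"
    and sing: "\<And>e. e \<in> E \<Longrightarrow> \<exists>c. \<forall>\<^sub>F z in at (of_real e) within {z. Im z > 0}.
                  norm (h z) \<le> c * norm (z - of_real e) powr (-1/2)"
  shows "\<exists>M. \<forall>x y. \<bar>x\<bar> \<le> T \<longrightarrow> 0 < y \<longrightarrow> y \<le> 1 \<longrightarrow> x \<notin> E \<longrightarrow> norm (h (Complex x y)) \<le> M * w x"
proof -
  have w1: "w x \<ge> 1" for x by (auto simp: w_def intro!: sum_nonneg)
  then have w0: "w x > 0" for x using less_le_trans[OF zero_less_one] by blast
  define S where "S = {z. Im z > 0 \<and> Re z \<notin> E}"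
  define Q where "Q = cbox (Complex (-T) 0) (Complex T 1)"
  have tends: "\<exists>M. \<forall>\<^sub>F z in nhds p. z \<in> S \<longrightarrow> norm (h z) / w (Re z) \<le> M"
    if l: "(h \<longlongrightarrow> l) (at p within {z. Im z > 0})" for p l
  proof (intro exI)
    have "((\<lambda>z. norm (h z)) \<longlongrightarrow> norm l) (at p within {z. Im z > 0})"
      using l by (rule tendsto_norm)
    then have "\<forall>\<^sub>F z in at p within {z. Im z > 0}. norm (h z) < norm l + 1"
      by (rule order_tendstoD) simp
    then have "\<forall>\<^sub>F z in nhds p. z \<noteq> p \<longrightarrow> Im z > 0 \<longrightarrow> norm (h z) < norm l + 1"
      by (simp add: eventually_at_filter)
    then show "\<forall>\<^sub>F z in nhds p. z \<in> S \<longrightarrow> norm (h z) / w (Re z) \<le> max (norm l + 1) (norm (h p))"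
    proof eventually_elim
      case (elim z)
      show ?case
      proof
        assume "z \<in> S"
        with elim have "norm (h z) \<le> max (norm l + 1) (norm (h p))"
          by (cases "z = p") (auto simp: S_def)
        also have "\<dots> \<le> max (norm l + 1) (norm (h p)) * w (Re z)"
          using mult_left_mono[OF w1[of "Re z"], of "max (norm l + 1) (norm (h p))"]
          by (simp add: le_max_iff_disj del: max.bounded_iff)
        finally show "norm (h z) / w (Re z) \<le> max (norm l + 1) (norm (h p))"
          using w0[of "Re z"] by (simp add: pos_divide_le_eq)
      qed
    qed
  qed
  have "\<exists>M. \<forall>z\<in>Q \<inter> S. norm (h z) / w (Re z) \<le> M"
  proof (rule locally_bounded_above_on_compact)
    show "compact Q" unfolding Q_def by (rule compact_cbox)
    fix p assume "p \<in> Q"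
    then have "Im p \<ge> 0" by (auto simp: Q_def in_cbox_complex_iff)
    then consider "Im p > 0" | x where "p = of_real x" "x \<notin> E" | x where "p = of_real x" "x \<in> E"
      by (metis complex_is_Real_iff Reals_cases order_le_less)
    then show "\<exists>M. \<forall>\<^sub>F z in nhds p. z \<in> S \<longrightarrow> norm (h z) / w (Re z) \<le> M"
    proof cases
      case 1
      then have "(h \<longlongrightarrow> h p) (at p within {z. Im z > 0})"
        using cont by (simp add: continuous_on)
      then show ?thesis by (rule tends)
    next
      case 2
      then show ?thesis using tends boundary by blast
    next
      case (3 e)
      from sing[OF 3(2)] obtain c where
        "\<forall>\<^sub>F z in nhds p. z \<noteq> p \<longrightarrow> Im z > 0 \<longrightarrow> norm (h z) \<le> c * norm (z - of_real e) powr (-1/2)"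
        by (auto simp: eventually_at_filter 3)
      then have "\<forall>\<^sub>F z in nhds p. z \<in> S \<longrightarrow> norm (h z) / w (Re z) \<le> \<bar>c\<bar>"
      proof eventually_elim
        case (elim z)
        show ?case
        proof
          assume z: "z \<in> S"
          then have "Re z \<noteq> e" "z \<noteq> p" using 3 by (auto simp: S_def)
          have "norm (h z) \<le> c * norm (z - of_real e) powr (-1/2)"
            using elim z 3 by (auto simp: S_def)
          also have "\<dots> \<le> \<bar>c\<bar> * norm (z - of_real e) powr (-1/2)"
            by (intro mult_right_mono) auto
          also have "norm (z - of_real e) powr (-1/2) \<le> \<bar>Re z - e\<bar> powr (-1/2)"
            using abs_Re_le_cmod[of "z - of_real e"] \<open>Re z \<noteq> e\<close> by (intro powr_mono2') auto
          also have "\<bar>Re z - e\<bar> powr (-1/2) \<le> (\<Sum>e\<in>E. \<bar>Re z - e\<bar> powr (-1/2))"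
            using 3 \<open>finite E\<close> by (intro member_le_sum) auto
          also have "\<dots> \<le> w (Re z)" by (simp add: w_def)
          finally show "norm (h z) / w (Re z) \<le> \<bar>c\<bar>"
            using w0[of "Re z"] by (simp add: pos_divide_le_eq mult_left_mono)
        qed
      qed
      then show ?thesis by blast
    qed
  qed
  then obtain M where M: "\<And>z. z \<in> Q \<Longrightarrow> z \<in> S \<Longrightarrow> norm (h z) \<le> M * w (Re z)"
    using w0 by (auto simp: pos_divide_le_eq)
  show ?thesis
  proof (intro exI allI impI)
    fix x y :: real assume "\<bar>x\<bar> \<le> T" "0 < y" "y \<le> 1" "x \<notin> E"
    then show "norm (h (Complex x y)) \<le> M * w x"
      using M[of "Complex x y"] by (auto simp: Q_def S_def in_cbox_complex_iff abs_le_iff)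
  qed
qed

text \<open>
  Decay of order \<open>-2\<close> at infinity forces the boundary values of \<open>h\<close> to have integral zero over
  the real line, provided that the boundary singularities are integrable. A nonnegative real part
  then leaves no room. Only finite intervals are needed: the integral of \<open>Re hp\<close> over a fixed
  interval around \<open>x0\<close> is at most the one over \<open>{-T..T}\<close>, which is \<open>O(1/T)\<close>.
\<close>

lemma boundary_real_part_vanishes:
  fixes h :: "complex \<Rightarrow> complex" and hp :: "real \<Rightarrow> complex" and E :: "real set"
  assumes "finite E"
    and hol: "h holomorphic_on {z. Im z > 0}"
    and boundary: "\<And>x. x \<notin> E \<Longrightarrow> (h \<longlongrightarrow> hp x) (at (of_real x) within {z. Im z > 0})"
    and hp_cont: "continuous_on (- E) hp"
    and decay: "\<And>z. Im z > 0 \<Longrightarrow> R \<le> norm z \<Longrightarrow> norm (h z) \<le> C / (norm z)\<^sup>2"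
    and sing: "\<And>e. e \<in> E \<Longrightarrow> \<exists>c. \<forall>\<^sub>F z in at (of_real e) within {z. Im z > 0}.
                  norm (h z) \<le> c * norm (z - of_real e) powr (-1/2)"
    and nonneg: "\<And>x. x \<notin> E \<Longrightarrow> Re (hp x) \<ge> 0"
    and "x0 \<notin> E"
  shows "Re (hp x0) = 0"
proof -
  have "open (- E)"
    using \<open>finite E\<close> by (simp add: finite_imp_closed open_Compl)
  from open_contains_cball_eq[OF this] obtain \<delta> where "\<delta> > 0" and \<delta>: "cball x0 \<delta> \<subseteq> - E"
    using \<open>x0 \<notin> E\<close> by (metis ComplI)
  define c d where "c = x0 - \<delta>" and "d = x0 + \<delta>"
  have cd: "{c..d} \<subseteq> - E" using \<delta> by (simp add: cball_eq_atLeastAtMost c_def d_def)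
  have cont_cd: "continuous_on {c..d} (\<lambda>x. Re (hp x))"
    using continuous_on_subset[OF hp_cont cd] by (intro continuous_intros)
  define w where "w = (\<lambda>x. 1 + (\<Sum>e\<in>E. \<bar>x - e\<bar> powr (-1/2)))"
  define y :: "nat \<Rightarrow> real" where "y = (\<lambda>n. inverse (Suc n))"
  have y: "y n > 0" "y n \<le> 1" for n
    by (auto simp: y_def inverse_le_1_iff)
  have ylim: "y \<longlonglongrightarrow> 0" unfolding y_def by (rule LIMSEQ_inverse_real_of_nat)
  have bound: "integral {c..d} (\<lambda>x. Re (hp x)) \<le> 4 * \<bar>C\<bar> / T"
    if T: "T \<ge> R" "T \<ge> \<bar>x0\<bar> + \<delta>" for T
  proof -
    have "T > 0" using T \<open>\<delta> > 0\<close> by linarith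
    \<comment> \<open>At \<open>e \<in> E\<close> the majorant \<open>w\<close> takes a junk value (\<open>0 powr (-1/2) = 0\<close>), while \<open>h\<close> may be
      unbounded on the vertical line above \<open>e\<close>; the domination holds off \<open>E\<close> only.\<close>
    define S where "S = {-T..T} - E"
    have spike: "negligible (({-T..T} - S) \<union> (S - {-T..T}))"
      by (rule negligible_finite) (use \<open>finite E\<close> in \<open>auto simp: S_def intro: finite_subset\<close>)
    have "\<bar>C\<bar> / (norm z)\<^sup>2 \<ge> norm (h z)" if "Im z > 0" "T \<le> norm z" for z
      using order_trans[OF decay[of z], of "\<bar>C\<bar> / (norm z)\<^sup>2"] that T by (simp add: divide_right_mono)
    then have "\<exists>J. ((\<lambda>x. h (Complex x (y n))) has_integral J) {-T..T} \<and> norm J \<le> 4 * \<bar>C\<bar> / T" for n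
      using horizontal_integral_bound[OF hol, of T "\<bar>C\<bar>" "y n"] \<open>T > 0\<close> y by (metis abs_ge_zero)
    then obtain J where J: "\<And>n. ((\<lambda>x. h (Complex x (y n))) has_integral J n) {-T..T}"
        and Jle: "\<And>n. norm (J n) \<le> 4 * \<bar>C\<bar> / T"
      by metis
    have f: "((\<lambda>x. Re (h (Complex x (y n)))) has_integral Re (J n)) S" for n
      using has_integral_linear[OF J bounded_linear_Re, of n] spike
      by (subst has_integral_spike_set_eq[of S "{-T..T}"])
        (auto simp: o_def S_def intro!: negligible_finite finite_subset[OF _ \<open>finite E\<close>])
    obtain M where M: "\<And>x y. \<lbrakk>\<bar>x\<bar> \<le> T; 0 < y; y \<le> 1; x \<notin> E\<rbrakk> \<Longrightarrow> norm (h (Complex x y)) \<le> M * w x"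
      using upper_halfplane_dominated[OF \<open>finite E\<close> holomorphic_on_imp_continuous_on[OF hol] boundary sing, of T]
      unfolding w_def by blast
    have "w integrable_on {-T..T}"
      unfolding w_def
      by (intro integrable_add integrable_sum \<open>finite E\<close> integrable_inverse_sqrt_singularity
          integrable_const_ivl)
    then have dom: "(\<lambda>x. M * w x) integrable_on S"
      using integrable_spike_set_eq[OF spike] by (intro integrable_on_mult_right) blast
    have le: "norm (Re (h (Complex x (y n)))) \<le> M * w x" if "x \<in> S" for n x
      unfolding real_norm_def using that y[of n]
      by (intro order_trans[OF abs_Re_le_cmod M]) (auto simp: S_def abs_le_iff)
    have lim: "(\<lambda>n. Re (h (Complex x (y n)))) \<longlonglongrightarrow> Re (hp x)" if "x \<in> S" for x
    proof -
      have "(\<lambda>n. of_real x + \<i> * of_real (y n)) \<longlonglongrightarrow> of_real x + \<i> * of_real 0"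
        by (intro tendsto_intros ylim)
      then have "filterlim (\<lambda>n. Complex x (y n)) (at (of_real x) within {z. Im z > 0}) sequentially"
        using y by (auto simp: filterlim_at Complex_eq complex_eq_iff less_imp_neq[symmetric])
      then have "(\<lambda>n. h (Complex x (y n))) \<longlonglongrightarrow> hp x"
        using filterlim_compose[OF boundary] that by (auto simp: S_def)
      then show ?thesis by (rule tendsto_Re)
    qed
    note DC = dominated_convergence[OF has_integral_integrable[OF f] dom le lim]
    have "integral {c..d} (\<lambda>x. Re (hp x)) \<le> integral S (\<lambda>x. Re (hp x))"
    proof (rule integral_subset_le)
      show "{c..d} \<subseteq> S" using cd T by (auto simp: S_def c_def d_def)
      show "(\<lambda>x. Re (hp x)) integrable_on {c..d}"
        using cont_cd by (rule integrable_continuous_real)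
    qed (use DC(1) nonneg in \<open>auto simp: S_def\<close>)
    also have "\<dots> \<le> 4 * \<bar>C\<bar> / T"
    proof (rule LIMSEQ_le_const2[OF DC(2)])
      show "\<exists>N. \<forall>n\<ge>N. integral S (\<lambda>x. Re (h (Complex x (y n)))) \<le> 4 * \<bar>C\<bar> / T"
        using order_trans[OF complex_Re_le_cmod Jle] by (simp add: integral_unique[OF f])
    qed
    finally show ?thesis .
  qed
  have "((\<lambda>T. 4 * \<bar>C\<bar> / T) \<longlongrightarrow> 0) at_top"
    by (intro tendsto_divide_0[OF tendsto_const] filterlim_at_top_imp_at_infinity filterlim_ident)
  moreover have "\<forall>\<^sub>F T in at_top. integral {c..d} (\<lambda>x. Re (hp x)) \<le> 4 * \<bar>C\<bar> / T"
    using eventually_ge_at_top[of R] eventually_ge_at_top[of "\<bar>x0\<bar> + \<delta>"]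
    by eventually_elim (rule bound)
  ultimately have "integral {c..d} (\<lambda>x. Re (hp x)) \<le> 0"
    by (rule tendsto_lowerbound) simp
  moreover have "integral {c..d} (\<lambda>x. Re (hp x)) \<ge> 0"
    using cd nonneg by (intro integral_nonneg integrable_continuous_real cont_cd) auto
  ultimately have "integral {c..d} (\<lambda>x. Re (hp x)) = 0" by (rule antisym)
  moreover have "c < d" "\<And>x. x \<in> {c..d} \<Longrightarrow> Re (hp x) \<ge> 0"
    using \<open>\<delta> > 0\<close> nonneg cd by (auto simp: c_def d_def)
  ultimately have "\<forall>x\<in>{c..d}. Re (hp x) = 0"
    using integral_eq_0_iff[OF cont_cd] by simp
  then show ?thesis using \<open>\<delta> > 0\<close> by (simp add: c_def d_def)
qed

text \<open>
  Extended by zero to the lower half plane, \<open>f\<close> is continuous across the interval, hence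
  holomorphic there; the extension vanishes on an open set and therefore identically.
\<close>

lemma zero_from_zero_boundary_values:
  fixes f :: "complex \<Rightarrow> complex"
  assumes hol: "f holomorphic_on {z. Im z > 0}"
    and "c < d"
    and zero: "\<And>x. c < x \<Longrightarrow> x < d \<Longrightarrow> (f \<longlongrightarrow> 0) (at (of_real x) within {z. Im z > 0})"
    and "Im z > 0"
  shows "f z = 0"
proof -
  define F where "F = (\<lambda>z. if Im z > 0 then f z else 0)"
  define S where "S = {z. c < Re z} \<inter> {z. Re z < d}"
  have "convex S" unfolding S_def
    by (intro convex_Int convex_halfspace_Re_gt convex_halfspace_Re_lt)
  have "open S" unfolding S_def
    by (intro open_Int open_halfspace_Re_gt open_halfspace_Re_lt)
  have holU: "F holomorphic_on {z. Im z > 0}"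
    using hol by (rule holomorphic_transform) (simp add: F_def)
  have holL: "F holomorphic_on {z. Im z < 0}"
    using holomorphic_on_const[of 0] by (rule holomorphic_transform) (simp add: F_def)
  have "isCont F p" if "p \<in> S" for p
  proof -
    consider "Im p > 0" | "Im p < 0" | "Im p = 0" by linarith
    then show ?thesis
    proof cases
      case 1
      then show ?thesis
        using holomorphic_on_imp_continuous_on[OF holU]
        by (simp add: continuous_on_eq_continuous_at open_halfspace_Im_gt)
    next
      case 2
      then show ?thesis
        using holomorphic_on_imp_continuous_on[OF holL]
        by (simp add: continuous_on_eq_continuous_at open_halfspace_Im_lt)
    next
      case 3
      then have p: "p = of_real (Re p)" by (simp add: complex_eq_iff)
      have "(f \<longlongrightarrow> 0) (at p within {z. Im z > 0})"
        using zero[of "Re p"] that p by (simp add: S_def)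
      then have "(F \<longlongrightarrow> 0) (at p)"
        unfolding F_def by (rule filterlim_at_If) (rule tendsto_const)
      then show ?thesis using 3 by (simp add: isCont_def F_def)
    qed
  qed
  then have contF: "continuous_on S F"
    by (intro continuous_at_imp_continuous_on) auto
  have "F holomorphic_on S"
  proof (rule holomorphic_on_paste_across_line[where d=\<i> and k=0])
    show "F holomorphic_on S \<inter> {z. \<i> \<bullet> z < 0}"
      using holL by (rule holomorphic_on_subset) auto
    show "F holomorphic_on S \<inter> {z. 0 < \<i> \<bullet> z}"
      using holU by (rule holomorphic_on_subset) auto
  qed (use \<open>open S\<close> contF in auto)
  define m where "m = (c + d) / 2"
  have m: "c < m" "m < d" using \<open>c < d\<close> by (auto simp: m_def)
  have F0: "F z = 0" if "z \<in> S" for z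
  proof (rule analytic_continuation[where f=F and S=S and U="S \<inter> {z. Im z < 0}"])
    show "Complex m (-1) islimpt S \<inter> {z. Im z < 0}"
      using m \<open>open S\<close> by (intro interior_limit_point)
        (auto simp: S_def interior_open open_Int open_halfspace_Im_lt open_halfspace_Re_gt open_halfspace_Re_lt)
    show "Complex m (-1) \<in> S" using m by (simp add: S_def)
  qed (use \<open>F holomorphic_on S\<close> \<open>open S\<close> \<open>convex S\<close> that in \<open>auto simp: convex_connected F_def\<close>)
  show "f z = 0"
  proof (rule analytic_continuation[where f=f and S="{z. Im z > 0}" and U="S \<inter> {z. Im z > 0}"])
    show "Complex m 1 islimpt S \<inter> {z. Im z > 0}"
      using m \<open>open S\<close> by (intro interior_limit_point)
        (auto simp: S_def interior_open open_Int open_halfspace_Im_gt open_halfspace_Re_gt open_halfspace_Re_lt)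
    show "f z = 0" if "z \<in> S \<inter> {z. Im z > 0}" for z
      using F0[of z] that by (simp add: F_def)
  qed (use hol \<open>Im z > 0\<close> in \<open>auto simp: open_halfspace_Im_gt convex_connected convex_halfspace_Im_gt\<close>)
qed

lemma filterlim_cnj_lower_halfplane:
  "filterlim cnj (at (of_real x) within {z. Im z < 0}) (at (of_real x) within {z. Im z > 0})"
proof -
  have "(cnj \<longlongrightarrow> of_real x) (at (of_real x) within {z. Im z > 0})"
    using tendsto_cnj[OF tendsto_ident_at, of "of_real x" "{z. Im z > 0}"] by simp
  then show ?thesis
    by (auto simp: filterlim_at eventually_at_filter complex_eq_iff)
qed

section \<open>A sesquilinear form adapted to the jumps\<close>

text \<open>
  This is \<open>u J v^*\<close> for row vectors, where \<open>J\<close> is the inverse of the jump matrix on the bands.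
  With this choice the band jump becomes the identity, while \<open>J\<close> itself and the gap jumps times
  \<open>J\<close> are skew-Hermitian.
\<close>

definition twisted_pairing ::
  "complex ^ ('r::finite + 'r) \<Rightarrow> complex ^ ('r + 'r) \<Rightarrow> complex" where
  "twisted_pairing u v =
     (\<Sum>k\<in>UNIV. u $ Inr k * cnj (v $ Inl k) - u $ Inl k * cnj (v $ Inr k))"

lemma sum_UNIV_Plus:
  fixes f :: "('a::finite + 'b::finite) \<Rightarrow> 'c::comm_monoid_add"
  shows "(\<Sum>i\<in>UNIV. f i) = (\<Sum>k\<in>UNIV. f (Inl k)) + (\<Sum>k\<in>UNIV. f (Inr k))"
  using sum.Plus[of UNIV UNIV f] by simp

lemma Re_twisted_pairing_self: "Re (twisted_pairing u u) = 0"
  by (simp add: twisted_pairing_def algebra_simps)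

lemma twisted_pairing_band_jump:
  "twisted_pairing ((M ** block_matrix 0 (mat 1) (- mat 1) 0) $ i) (M $ i)
     = of_real (\<Sum>j\<in>UNIV. (norm (M $ i $ j))\<^sup>2)"
proof -
  have l: "(M ** block_matrix 0 (mat 1) (- mat 1) 0) $ i $ Inl k = - M $ i $ Inr k" for k
    by (simp add: matrix_matrix_mult_def block_matrix_def sum_UNIV_Plus mat_def
        if_distrib[of "\<lambda>x. - x"] if_distrib[of "\<lambda>x. _ * x"] sum_negf cong: if_cong)
  have r: "(M ** block_matrix 0 (mat 1) (- mat 1) 0) $ i $ Inr k = M $ i $ Inl k" for k
    by (simp add: matrix_matrix_mult_def block_matrix_def sum_UNIV_Plus mat_def
        if_distrib[of "\<lambda>x. _ * x"] cong: if_cong)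
  show ?thesis
    by (simp add: twisted_pairing_def l r sum_UNIV_Plus sum.distrib complex_norm_square
        del: of_real_power)
qed

lemma matrix_inv_unitary:
  assumes "unitary_matrix U"
  shows "matrix_inv U = adjoint_matrix U"
proof -
  have U: "U ** adjoint_matrix U = mat 1 \<and> adjoint_matrix U ** U = mat 1"
    using assms by (simp add: unitary_matrix_def)
  then have "U ** matrix_inv U = mat 1"
    unfolding matrix_inv_def by (rule someI2) simp
  then have "adjoint_matrix U ** (U ** matrix_inv U) = adjoint_matrix U" by simp
  then show ?thesis using U by (simp add: matrix_mul_assoc)
qed

text \<open>
  The two blocks of the gap jump are \<open>U\<close> and \<open>U^*\<close>, so the two sums in the pairing are complex
  conjugates of each other.
\<close>

lemma Re_twisted_pairing_gap_jump:
  assumes "unitary_matrix U"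
  shows "Re (twisted_pairing ((M ** block_matrix U 0 0 (matrix_inv U)) $ i) (M $ i)) = 0"
proof -
  let ?P = "M ** block_matrix U 0 0 (matrix_inv U)"
  define q where "q = (\<Sum>k\<in>UNIV. \<Sum>l\<in>UNIV. M $ i $ Inl l * U $ l $ k * cnj (M $ i $ Inr k))"
  have l: "?P $ i $ Inl k = (\<Sum>l\<in>UNIV. M $ i $ Inl l * U $ l $ k)" for k
    by (simp add: matrix_matrix_mult_def block_matrix_def sum_UNIV_Plus)
  have r: "?P $ i $ Inr k = (\<Sum>l\<in>UNIV. M $ i $ Inr l * cnj (U $ k $ l))" for k
    by (simp add: matrix_matrix_mult_def block_matrix_def sum_UNIV_Plus
        matrix_inv_unitary[OF assms] adjoint_matrix_def)
  have "(\<Sum>k\<in>UNIV. ?P $ i $ Inr k * cnj (M $ i $ Inl k))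
      = (\<Sum>k\<in>UNIV. \<Sum>l\<in>UNIV. M $ i $ Inr l * cnj (U $ k $ l) * cnj (M $ i $ Inl k))"
    by (simp add: r sum_distrib_right)
  also have "\<dots> = cnj q"
    by (subst sum.swap) (simp add: q_def mult_ac)
  finally have "twisted_pairing (?P $ i) (M $ i) = cnj q - q"
    by (simp add: twisted_pairing_def sum_subtractf l q_def sum_distrib_right)
  then show ?thesis by simp
qed

lemma norm_twisted_pairing_le:
  fixes u v :: "complex ^ ('r::finite + 'r)"
  shows "norm (twisted_pairing u v) \<le> 2 * CARD('r) * (norm u * norm v)"
proof -
  have "norm (u $ Inr k * cnj (v $ Inl k) - u $ Inl k * cnj (v $ Inr k)) \<le> 2 * (norm u * norm v)" for k
  proof -
    have "norm (u $ Inr k * cnj (v $ Inl k)) \<le> norm u * norm v"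
         "norm (u $ Inl k * cnj (v $ Inr k)) \<le> norm u * norm v"
      by (simp_all add: norm_mult mult_mono Finite_Cartesian_Product.norm_nth_le)
    then show ?thesis
      using norm_triangle_ineq4[of "u $ Inr k * cnj (v $ Inl k)" "u $ Inl k * cnj (v $ Inr k)"]
      by linarith
  qed
  then have "norm (twisted_pairing u v) \<le> (\<Sum>k\<in>(UNIV::'r set). 2 * (norm u * norm v))"
    unfolding twisted_pairing_def by (rule sum_norm_le)
  then show ?thesis by simp
qed

section \<open>Ordering of bands and gaps\<close>

lemma band_right_ends_mono:
  fixes a b :: "nat \<Rightarrow> real"
  assumes bands: "\<And>l. l \<le> g \<Longrightarrow> a l < b l"
    and gaps: "\<And>l. l < g \<Longrightarrow> b l < a (Suc l)"
    and "m \<le> n" "n \<le> g"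
  shows "b m \<le> b n"
  using \<open>m \<le> n\<close> \<open>n \<le> g\<close>
proof (induction n rule: dec_induct)
  case (step n)
  then show ?case using gaps[of n] bands[of "Suc n"] by simp
qed simp

text \<open>
  The ordering of the endpoints makes the gaps disjoint, which identifies the index chosen by
  \<open>THE\<close>.
\<close>

lemma jump_matrix_gap:
  fixes a b :: "nat \<Rightarrow> real"
  assumes bands: "\<And>l. l \<le> g \<Longrightarrow> a l < b l"
    and gaps: "\<And>l. l < g \<Longrightarrow> b l < a (Suc l)"
    and no_band: "\<not> (\<exists>l\<in>{0..g}. x \<in> {a l<..<b l})"
    and j: "j \<in> {1..g}" "x \<in> {b (j - 1)<..<a j}"
  shows "jump_matrix g a b K x = block_matrix (K j) 0 0 (matrix_inv (K j))"
proof -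
  have separate: False
    if "k \<in> {1..g}" "l \<in> {1..g}" "k < l" "x < a k" "b (l - 1) < x" for k l
  proof -
    have "k \<le> l - 1" "l - 1 \<le> g" "k \<le> g" using that by auto
    then show False
      using bands[of k] band_right_ends_mono[of g a b k "l - 1", OF bands gaps] that by linarith
  qed
  have unique: "(THE k. k \<in> {1..g} \<and> x \<in> {b (k - 1)<..<a k}) = j"
  proof (rule the_equality)
    fix k assume "k \<in> {1..g} \<and> x \<in> {b (k - 1)<..<a k}"
    then show "k = j"
      using separate[of k j] separate[of j k] j by (cases k j rule: linorder_cases) auto
  qed (use j in blast)
  have gap: "\<exists>j\<in>{1..g}. x \<in> {b (j - 1)<..<a j}" using j by blast
  show ?thesis
    by (simp only: jump_matrix_def if_not_P[OF no_band] if_P[OF gap] unique Let_def)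
qed

section \<open>Vanishing of the solution\<close>

theorem proposition5p2:
  fixes g :: nat
    and a b :: "nat \<Rightarrow> real"
    and K :: "nat \<Rightarrow> complex ^ 'r ^ 'r"
    and N :: "complex \<Rightarrow> complex ^ ('r + 'r) ^ ('r + 'r)"
    and Np Nm :: "real \<Rightarrow> complex ^ ('r + 'r) ^ ('r + 'r)"
  defines "E \<equiv> band_endpoints g a b"
    and "D \<equiv> - complex_of_real ` {a 0..b g}"
  assumes bands: "\<And>l. l \<le> g \<Longrightarrow> a l < b l"
    and gaps: "\<And>l. l < g \<Longrightarrow> b l < a (Suc l)"
    and unitary: "\<And>j. j \<in> {1..g} \<Longrightarrow> unitary_matrix (K j)"
    and holomorphic: "\<And>i j. (\<lambda>z. N z $ i $ j) holomorphic_on D"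
    and boundary_plus: "\<And>x. x \<notin> E \<Longrightarrow>
          (N \<longlongrightarrow> Np x) (at (complex_of_real x) within {z. Im z > 0})"
    and boundary_minus: "\<And>x. x \<notin> E \<Longrightarrow>
          (N \<longlongrightarrow> Nm x) (at (complex_of_real x) within {z. Im z < 0})"
    and continuous_plus: "continuous_on (- E) Np"
    and continuous_minus: "continuous_on (- E) Nm"
    and jump: "\<And>x. x \<notin> E \<Longrightarrow> Np x = Nm x ** jump_matrix g a b K x"
    and at_infty: "(\<lambda>z. norm (N z)) \<in> O[at_infinity](\<lambda>z. 1 / norm z)"
    and at_endpoints: "\<And>e. e \<in> E \<Longrightarrow>
          (\<lambda>z. norm (N z)) \<in> O[at (complex_of_real e) within D](
            \<lambda>z. norm (z - complex_of_real e) powr (- 1 / 4))"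
  shows "\<forall>z\<in>D. N z = 0"
proof -
  let ?UH = "{z::complex. Im z > 0}" and ?LH = "{z::complex. Im z < 0}"
  have "finite E" by (simp add: E_def band_endpoints_def)
  have UH_D: "?UH \<subseteq> D" and LH_D: "?LH \<subseteq> D" by (auto simp: D_def)
  have "open D"
    unfolding D_def by (intro open_Compl compact_imp_closed compact_continuous_image) (auto intro: continuous_intros)
  have "connected D"
    unfolding D_def
    by (intro connected_complement_bounded_convex convex_linear_image compact_imp_bounded compact_continuous_image)
      (auto intro: continuous_intros simp: bounded_linear_of_real bounded_linear.linear)
  have band_jump: "jump_matrix g a b K x = block_matrix 0 (mat 1) (- mat 1) 0"
    if "\<exists>l\<in>{0..g}. x \<in> {a l<..<b l}" for x
    unfolding jump_matrix_def using that by (rule if_P)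
  have first_band: "x \<notin> E" if "a 0 < x" "x < b 0" for x
  proof
    assume "x \<in> E"
    then obtain l where l: "l \<le> g" "x = a l \<or> x = b l"
      by (auto simp: E_def band_endpoints_def)
    have "b 0 \<le> b l" using band_right_ends_mono[of g a b 0 l, OF bands gaps] l by simp
    with that l have "x = a l" by auto
    then have "l \<noteq> 0" using that by (metis less_irrefl)
    then obtain m where "l = Suc m" using not0_implies_Suc by blast
    have "b 0 \<le> b m" "b m < a l"
      using band_right_ends_mono[of g a b 0 m, OF bands gaps] gaps[of m] l \<open>l = Suc m\<close> by simp_all
    with \<open>x = a l\<close> that show False by linarith
  qed
  \<comment> \<open>The jump acts on \<open>N\<close> from the right, so each row can be treated by itself.\<close>
  have "N z $ i $ j = 0" if "z \<in> D" for z i j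
  proof -
    define h where "h = (\<lambda>z. twisted_pairing (N z $ i) (N (cnj z) $ i))"
    define hp where "hp = (\<lambda>x. twisted_pairing (Np x $ i) (Nm x $ i))"
    define A :: real where "A = 2 * CARD('r)"
    have h_le: "norm (h z) \<le> A * (norm (N z) * norm (N (cnj z)))" for z
    proof -
      have "norm (h z) \<le> A * (norm (N z $ i) * norm (N (cnj z) $ i))"
        unfolding h_def A_def by (rule norm_twisted_pairing_le)
      also have "\<dots> \<le> A * (norm (N z) * norm (N (cnj z)))"
        by (intro mult_left_mono mult_mono Finite_Cartesian_Product.norm_nth_le) (auto simp: A_def)
      finally show ?thesis .
    qed
    have hol_N: "(\<lambda>z. N z $ i $ k) holomorphic_on ?UH" for k
      using holomorphic UH_D by (rule holomorphic_on_subset)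
    have "cnj \<circ> (\<lambda>z. N z $ i $ k) \<circ> cnj holomorphic_on ?UH" for k
      using LH_D
      by (intro holomorphic_on_compose_cnj_cnj holomorphic_on_subset[OF holomorphic] open_halfspace_Im_gt) auto
    then have hol_cnj: "(\<lambda>z. cnj (N (cnj z) $ i $ k)) holomorphic_on ?UH" for k
      by (simp add: o_def)
    have hol_h: "h holomorphic_on ?UH"
      unfolding h_def twisted_pairing_def by (intro holomorphic_intros hol_N hol_cnj)
    have boundary: "(h \<longlongrightarrow> hp x) (at (of_real x) within ?UH)" if "x \<notin> E" for x
    proof -
      have "((\<lambda>z. N (cnj z)) \<longlongrightarrow> Nm x) (at (of_real x) within ?UH)"
        using boundary_minus[OF that] filterlim_cnj_lower_halfplane by (rule filterlim_compose)
      with boundary_plus[OF that] show ?thesis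
        unfolding h_def hp_def twisted_pairing_def
        by (intro tendsto_intros)
    qed
    have hp_cont: "continuous_on (- E) hp"
      unfolding hp_def twisted_pairing_def
      by (intro continuous_intros continuous_plus continuous_minus)
    obtain c R where cR: "\<And>z. R \<le> norm z \<Longrightarrow> norm (N z) \<le> c / norm z"
    proof -
      from at_infty obtain c where "\<forall>\<^sub>F z in at_infinity. norm (N z) \<le> c / norm z"
        by (auto elim!: landau_o.bigE)
      then show thesis using that unfolding eventually_at_infinity by blast
    qed
    have decay: "norm (h z) \<le> (A * c\<^sup>2) / (norm z)\<^sup>2" if "R \<le> norm z" for z
    proof -
      have "norm (N z) * norm (N (cnj z)) \<le> (c / norm z) * (c / norm z)"
        using cR[of z] cR[of "cnj z"] that by (intro mult_mono order_trans[OF norm_ge_zero]) auto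
      then have "norm (h z) \<le> A * ((c / norm z) * (c / norm z))"
        by (intro order_trans[OF h_le] mult_left_mono) (auto simp: A_def)
      then show ?thesis by (simp add: power2_eq_square)
    qed
    have sing: "\<exists>c. \<forall>\<^sub>F z in at (of_real e) within ?UH. norm (h z) \<le> c * norm (z - of_real e) powr (-1/2)"
      if "e \<in> E" for e
    proof -
      let ?s = "\<lambda>z. norm (z - complex_of_real e) powr (-1/4)"
      from at_endpoints[OF that] obtain c
        where "\<forall>\<^sub>F z in at (of_real e) within D. norm (N z) \<le> c * ?s z"
        by (auto elim!: landau_o.bigE)
      then obtain \<delta> where "\<delta> > 0"
        and \<delta>: "\<And>z. z \<in> D \<Longrightarrow> z \<noteq> of_real e \<Longrightarrow> dist z (of_real e) < \<delta> \<Longrightarrow> norm (N z) \<le> c * ?s z"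
        unfolding eventually_at by blast
      have "norm (h z) \<le> (A * c\<^sup>2) * norm (z - of_real e) powr (-1/2)"
        if z: "z \<in> ?UH" "dist z (of_real e) < \<delta>" for z
      proof -
        have cnj_dist: "norm (cnj z - of_real e) = norm (z - of_real e)"
          using complex_mod_cnj[of "z - of_real e"] by simp
        have "z \<in> D" "cnj z \<in> D" "z \<noteq> of_real e" "cnj z \<noteq> of_real e"
          using z UH_D LH_D by (auto simp: complex_eq_iff)
        then have "norm (N z) \<le> c * ?s z" "norm (N (cnj z)) \<le> c * ?s z"
          using \<delta>[of z] \<delta>[of "cnj z"] z cnj_dist by (auto simp: dist_norm)
        then have "norm (N z) * norm (N (cnj z)) \<le> (c * ?s z) * (c * ?s z)"
          by (intro mult_mono order_trans[OF norm_ge_zero]) auto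
        also have "\<dots> = c\<^sup>2 * (?s z * ?s z)"
          by (simp add: power2_eq_square mult_ac)
        also have "?s z * ?s z = norm (z - of_real e) powr (-1/2)"
          by (simp flip: powr_add)
        finally have "norm (h z) \<le> A * (c\<^sup>2 * norm (z - of_real e) powr (-1/2))"
          by (intro order_trans[OF h_le] mult_left_mono) (auto simp: A_def)
        then show ?thesis by (simp add: mult.assoc)
      qed
      then show ?thesis
        unfolding eventually_at using \<open>\<delta> > 0\<close> by blast
    qed
    have nonneg: "Re (hp x) \<ge> 0" if "x \<notin> E" for x
    proof -
      have hp_jump: "hp x = twisted_pairing ((Nm x ** jump_matrix g a b K x) $ i) (Nm x $ i)"
        using jump[OF that] by (simp add: hp_def)
      consider "\<exists>l\<in>{0..g}. x \<in> {a l<..<b l}"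
        | j where "\<not> (\<exists>l\<in>{0..g}. x \<in> {a l<..<b l})" "j \<in> {1..g}" "x \<in> {b (j - 1)<..<a j}"
        | "\<not> (\<exists>l\<in>{0..g}. x \<in> {a l<..<b l})" "\<not> (\<exists>j\<in>{1..g}. x \<in> {b (j - 1)<..<a j})"
        by blast
      then show ?thesis
      proof cases
        case 1
        then show ?thesis
          unfolding hp_jump band_jump[OF 1] twisted_pairing_band_jump
          by (simp add: sum_nonneg del: of_real_sum)
      next
        case (2 j)
        from jump_matrix_gap[of g a b x j K, OF bands gaps 2] show ?thesis
          by (simp add: hp_jump Re_twisted_pairing_gap_jump[OF unitary[OF 2(2)]])
      next
        case 3
        then have "jump_matrix g a b K x = mat 1"
          by (simp only: jump_matrix_def if_False)
        then show ?thesis by (simp add: hp_jump Re_twisted_pairing_self)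
      qed
    qed
    have Np_zero: "Np x $ i $ k = 0" if "a 0 < x" "x < b 0" for x k
    proof -
      have x: "x \<notin> E" and jx: "jump_matrix g a b K x = block_matrix 0 (mat 1) (- mat 1) 0"
        using first_band band_jump that by force+
      have "Re (hp x) = 0"
        by (rule boundary_real_part_vanishes[OF \<open>finite E\<close> hol_h boundary hp_cont decay sing nonneg x])
      also have "hp x = of_real (\<Sum>k\<in>UNIV. (norm (Nm x $ i $ k))\<^sup>2)"
        unfolding hp_def jump[OF x] jx by (rule twisted_pairing_band_jump)
      finally have "\<forall>k. Nm x $ i $ k = 0"
        by (simp add: sum_nonneg_eq_0_iff del: of_real_sum)
      then show ?thesis
        by (simp add: jump[OF x] matrix_matrix_mult_def)
    qed
    have upper: "N z $ i $ j = 0" if "z \<in> ?UH" for z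
    proof (rule zero_from_zero_boundary_values[OF hol_N])
      show "a 0 < b 0" using bands by simp
      show "((\<lambda>z. N z $ i $ j) \<longlongrightarrow> 0) (at (of_real x) within ?UH)" if "a 0 < x" "x < b 0" for x
        using tendsto_vec_nth[OF tendsto_vec_nth[OF boundary_plus[OF first_band[OF that]]], of i j]
          Np_zero[OF that, of j] by simp
    qed (use that in simp)
    have lim: "\<i> islimpt ?UH"
      by (intro interior_limit_point) (simp add: interior_open open_halfspace_Im_gt)
    have iD: "\<i> \<in> D" using UH_D by auto
    show "N z $ i $ j = 0"
      by (rule analytic_continuation[where f="\<lambda>z. N z $ i $ j",
            OF holomorphic \<open>open D\<close> \<open>connected D\<close> UH_D iD lim upper \<open>z \<in> D\<close>])
  qed
  then show ?thesis by (simp add: vec_eq_iff)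
qed

end
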